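(* (i) For any Lipschitz $\phi:\mathbb R\to\mathbb R$ bounded from below and any $0<\lambda<\lambda'$, $\mathcal M^\lambda\phi\le\mathcal M^{\lambda'}\phi$ on $\mathbb R$. (ii) For any $\lambda>0$ and any $\phi\in\mathscr F$, $\mathcal M\phi\le\mathcal M^\lambda\phi$ on $\mathbb R$. (iii) For any Lipschitz $\phi$ bounded from below and any compact $K\subset\mathbb R$, $\lim_{\lambda\to0^+}\|\mathcal M^\lambda\phi-\mathcal M\phi\|_{L^\infty(K)}=0$.
   Context: Let $l:\mathbb R\to\mathbb R$ satisfy: there is $K_0>0$ with $\inf l=l(0)=K_0$ and $l(x)+l(y)\ge l(x+y)+K_0$ for all $x,y$; $l(\xi)\to+\infty$ as $|\xi|\to\infty$; $l$ is $L_l$-Lipschitz. $\Phi_x=\mathcal N(-x,1)$. For $\lambda>0$ and $\phi$ bounded below, $\mathcal M^\lambda\phi(x)=\inf\{\int(\phi(x+\xi)+l(\xi))\mu(d\xi)+\lambda D_{KL}(\mu\|\Phi_x)\}$ over probability measures $\mu\ll\Phi_x$ ($D_{KL}$ the Kullback–Leibler divergence); $\mathcal M\phi(x)=\inf_{\xi\in\mathbb R}[\phi(x+\xi)+l(\xi)]$. $\mathscr F$ is the set of $\phi:\mathbb R\to\mathbb R$ with $\inf\phi\in\mathbb R$ and $\sup_x|\phi(x)|/(1+|x|^\beta)<\infty$ for some $\beta\ge0$. *)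

theory Defs
  imports "HOL-Analysis.Analysis" "HOL-Probability.Probability"
begin

definition Phi :: "real \<Rightarrow> real measure" where
  "Phi x = density lborel (\<lambda>\<xi>. ennreal (normal_density (- x) 1 \<xi>))"

text \<open>Kullback-Leibler divergence D(mu || nu) with natural logarithm
 (library: KL_divergence b M N = integral over N of log_b (dN/dM)).\<close>
definition DKL :: "real measure \<Rightarrow> real measure \<Rightarrow> real" where
  "DKL \<mu> \<nu> = KL_divergence (exp 1) \<nu> \<mu>"

text \<open>Admissible measures: probability measures mu << Phi_x for which both the
 cost integral and the KL divergence are finite (measures with infinite value
 of the functional do not affect the infimum, since the functional is bounded below).\<close>
definition admissible :: "(real \<Rightarrow> real) \<Rightarrow> (real \<Rightarrow> real) \<Rightarrow> real \<Rightarrow> real measure \<Rightarrow> bool" where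
  "admissible l \<phi> x \<mu> \<longleftrightarrow> prob_space \<mu> \<and> sets \<mu> = sets borel \<and>
     absolutely_continuous (Phi x) \<mu> \<and>
     integrable \<mu> (\<lambda>\<xi>. \<phi> (x + \<xi>) + l \<xi>) \<and>
     integrable \<mu> (entropy_density (exp 1) (Phi x) \<mu>)"

definition Mlam :: "(real \<Rightarrow> real) \<Rightarrow> real \<Rightarrow> (real \<Rightarrow> real) \<Rightarrow> real \<Rightarrow> real" where
  "Mlam l lam \<phi> x = Inf {(\<integral>\<xi>. \<phi> (x + \<xi>) + l \<xi> \<partial>\<mu>) + lam * DKL \<mu> (Phi x) | \<mu>. admissible l \<phi> x \<mu>}"

definition Mop :: "(real \<Rightarrow> real) \<Rightarrow> (real \<Rightarrow> real) \<Rightarrow> real \<Rightarrow> real" where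
  "Mop l \<phi> x = (INF \<xi>. \<phi> (x + \<xi>) + l \<xi>)"

text \<open>The class F (the convention 0 powr 0 = 0 only affects the single point x = 0
 and is irrelevant for the boundedness of the quotient).\<close>
definition classF :: "(real \<Rightarrow> real) set" where
  "classF = {\<phi>. bdd_below (range \<phi>) \<and>
     (\<exists>\<beta>\<ge>0. bdd_above (range (\<lambda>x. \<bar>\<phi> x\<bar> / (1 + \<bar>x\<bar> powr \<beta>))))}"

end

theory Submission
  imports Defs
begin

text \<open>
  Since the Kullback-Leibler divergence of an admissible measure from \<open>Phi x\<close> is nonnegative,
  the entropic objective is monotone in \<open>\<lambda>\<close> and dominates the pointwise infimum \<open>Mop\<close>.

  For the small-\<open>\<lambda>\<close> limit, coercivity of \<open>l\<close> confines the near-minimisers \<open>a\<close> of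
  \<open>\<xi> \<mapsto> \<phi> (x + \<xi>) + l \<xi>\<close> to a bounded set, uniformly for \<open>x \<in> K\<close>. Testing \<open>Mlam\<close> with the
  uniform distribution on \<open>[a - d, a + d]\<close> costs at most \<open>(L + Ll) d\<close> above the minimum,
  plus \<open>\<lambda>\<close> times its divergence from the Gaussian, which is explicitly bounded in terms of
  \<open>d\<close> and \<open>|x + a|\<close>. Choosing first \<open>d\<close> and then \<open>\<lambda>\<close> small gives the uniform estimate.
\<close>

lemma (in information_space) KL_nonneg_ac:
  assumes "prob_space N"
  assumes ac: "absolutely_continuous M N" "sets N = sets M"
  assumes int: "integrable N (entropy_density b M N)"
  shows "0 \<le> KL_divergence b M N"
proof -
  interpret N: prob_space N by fact
  have "finite_measure N" by unfold_locales
  from real_RN_deriv[OF this ac] obtain D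
    where D:
      "random_variable borel D"
      "AE x in M. RN_deriv M N x = ennreal (D x)"
      "AE x in N. 0 < D x"
      "\<And>x. 0 \<le> D x"
    by this auto
  have "N = density M (RN_deriv M N)"
    using ac by (rule density_RN_deriv[symmetric])
  also have "\<dots> = density M D"
    using D by (auto intro!: density_cong)
  finally have N: "N = density M D" .
  from absolutely_continuous_AE[OF ac(2,1) D(2)] D b_gt_1 ac measurable_entropy_density
  have "integrable N (\<lambda>x. log b (D x))"
    by (intro integrable_cong_AE[THEN iffD2, OF _ _ _ int])
       (auto simp: N entropy_density_def)
  with D b_gt_1 have "integrable M (\<lambda>x. D x * log b (D x))"
    by (subst integrable_real_density[symmetric]) (auto simp: N[symmetric] comp_def)
  with \<open>prob_space N\<close> D show ?thesis
    unfolding N by (intro KL_nonneg) auto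
qed

lemma (in sigma_finite_measure) AE_entropy_density_density:
  fixes f g :: "'a \<Rightarrow> real"
  assumes [measurable]: "f \<in> borel_measurable M" "g \<in> borel_measurable M"
    and f_pos: "\<And>x. 0 < f x" and g_nonneg: "\<And>x. 0 \<le> g x"
  shows "AE x in density M g. entropy_density b (density M f) (density M g) x = log b (g x / f x)"
proof -
  interpret Mf: sigma_finite_measure "density M f"
    by (subst sigma_finite_iff_density_finite) auto
  have f_nonneg: "0 \<le> f x" and f_nonzero: "f x \<noteq> 0" for x
    using f_pos[of x] by simp_all
  have "density (density M f) (\<lambda>x. g x / f x) = density M g"
    using f_nonneg f_nonzero g_nonneg by (intro density_density_divide AE_I2) simp_all
  then have "AE x in density M f. ennreal (g x / f x) = RN_deriv (density M f) (density M g) x"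
    by (intro Mf.RN_deriv_unique) auto
  then have "AE x in M. ennreal (g x / f x) = RN_deriv (density M f) (density M g) x"
    using f_pos by (simp add: AE_density)
  then have "AE x in density M g. ennreal (g x / f x) = RN_deriv (density M f) (density M g) x"
    by (subst AE_density) auto
  then show ?thesis
  proof eventually_elim
    case (elim x)
    have "0 \<le> g x / f x" using f_nonneg g_nonneg by simp
    then show ?case by (simp add: entropy_density_def flip: elim)
  qed
qed

lemma AE_in_uniform_measure: "A \<in> sets M \<Longrightarrow> AE x in uniform_measure M A. x \<in> A"
  by (rule AE_uniform_measureI) auto

lemma powr_le_1_plus_power:
  fixes t \<beta> :: real
  assumes "0 \<le> t" "0 \<le> \<beta>"
  shows "t powr \<beta> \<le> 1 + t ^ nat \<lceil>\<beta>\<rceil>"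
proof (cases "t \<le> 1")
  case True
  then have "t powr \<beta> \<le> 1"
    using assms powr_mono2[of \<beta> t 1] by simp
  then show ?thesis using assms(1) by (simp add: add_increasing2)
next
  case False
  then have "t powr \<beta> \<le> t powr real (nat \<lceil>\<beta>\<rceil>)"
    by (intro powr_mono) linarith+
  also have "\<dots> = t ^ nat \<lceil>\<beta>\<rceil>"
    using False by (simp add: powr_realpow)
  finally show ?thesis by simp
qed

lemma lipschitz_on_translate:
  fixes f :: "'a::real_normed_vector \<Rightarrow> 'b::metric_space"
  assumes "L-lipschitz_on UNIV f"
  shows "L-lipschitz_on UNIV (\<lambda>y. f (c + y))"
proof (rule lipschitz_onI)
  fix y z
  show "dist (f (c + y)) (f (c + z)) \<le> L * dist y z"
    using lipschitz_onD[OF assms, of "c + y" "c + z"] by simp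
qed (rule lipschitz_on_nonneg[OF assms])

lemma lipschitz_on_linear_growth:
  assumes "L-lipschitz_on UNIV f"
  shows "\<bar>f y\<bar> \<le> max \<bar>f 0\<bar> L * (1 + \<bar>y\<bar>)"
proof -
  have "\<bar>f y\<bar> \<le> \<bar>f 0\<bar> + L * \<bar>y\<bar>"
    using lipschitz_onD[OF assms, of y 0] by (simp add: dist_real_def)
  also have "\<dots> \<le> (max \<bar>f 0\<bar> L) + (max \<bar>f 0\<bar> L) * \<bar>y\<bar>"
    by (intro add_mono mult_right_mono) auto
  finally show ?thesis by (simp add: algebra_simps)
qed

lemma borel_measurable_lipschitz:
  fixes f :: "'a::metric_space \<Rightarrow> 'b::metric_space"
  shows "L-lipschitz_on UNIV f \<Longrightarrow> f \<in> borel_measurable borel"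
  by (intro borel_measurable_continuous_onI lipschitz_on_continuous_on)

lemma prob_space_Phi: "prob_space (Phi x)"
  unfolding Phi_def using prob_space_normal_density[of 1 "-x"] by simp

lemma sets_Phi [simp, measurable_cong]: "sets (Phi x) = sets borel"
  unfolding Phi_def by simp

lemma null_sets_Phi: "null_sets (Phi x) = null_sets lborel"
proof (intro set_eqI)
  fix A
  have "normal_density (- x) 1 \<xi> \<noteq> 0" for \<xi>
    using normal_density_pos[of 1 "- x" \<xi>] by simp
  then have "A \<in> null_sets (Phi x) \<longleftrightarrow> A \<in> sets borel \<and> (AE \<xi> in lborel. \<xi> \<notin> A)"
    unfolding Phi_def by (simp add: null_sets_density_iff)
  also have "\<dots> \<longleftrightarrow> A \<in> null_sets lborel"
    by (metis AE_iff_null_sets null_setsD2 sets_lborel)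
  finally show "A \<in> null_sets (Phi x) \<longleftrightarrow> A \<in> null_sets lborel" .
qed

lemma information_space_Phi: "information_space (Phi x) (exp 1)"
  by (simp add: information_space_def information_space_axioms_def prob_space_Phi)

lemma integrable_Phi_abs_power: "integrable (Phi x) (\<lambda>\<xi>. \<bar>x + \<xi>\<bar> ^ n)"
proof -
  have "integrable lborel (\<lambda>\<xi>. normal_density (- x) 1 \<xi> * \<bar>\<xi> - (- x)\<bar> ^ n)"
    by (rule integrable_normal_moment_abs) simp
  then show ?thesis
    unfolding Phi_def by (subst integrable_density) (auto simp: add.commute)
qed

lemma integrable_Phi_polynomial_growth:
  assumes [measurable]: "f \<in> borel_measurable borel"
    and "0 \<le> \<beta>" and growth: "\<And>y. \<bar>f y\<bar> \<le> C * (1 + \<bar>y\<bar> powr \<beta>)"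
  shows "integrable (Phi x) (\<lambda>\<xi>. f (x + \<xi>))"
proof (rule Bochner_Integration.integrable_bound)
  interpret prob_space "Phi x" by (rule prob_space_Phi)
  let ?n = "nat \<lceil>\<beta>\<rceil>"
  show "integrable (Phi x) (\<lambda>\<xi>. \<bar>C\<bar> * (2 + \<bar>x + \<xi>\<bar> ^ ?n))"
    using integrable_Phi_abs_power by simp
  show "AE \<xi> in Phi x. norm (f (x + \<xi>)) \<le> norm (\<bar>C\<bar> * (2 + \<bar>x + \<xi>\<bar> ^ ?n))"
  proof (intro AE_I2)
    fix \<xi>
    have "\<bar>f (x + \<xi>)\<bar> \<le> \<bar>C\<bar> * (1 + \<bar>x + \<xi>\<bar> powr \<beta>)"
      using growth[of "x + \<xi>"]
      by (meson abs_ge_self add_nonneg_nonneg mult_right_mono order.trans powr_ge_zero zero_le_one)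
    also have "\<dots> \<le> \<bar>C\<bar> * (2 + \<bar>x + \<xi>\<bar> ^ ?n)"
      using powr_le_1_plus_power[of "\<bar>x + \<xi>\<bar>" \<beta>] \<open>0 \<le> \<beta>\<close> by (intro mult_left_mono) auto
    finally show "norm (f (x + \<xi>)) \<le> norm (\<bar>C\<bar> * (2 + \<bar>x + \<xi>\<bar> ^ ?n))" by simp
  qed
qed measurable

lemma integrable_Phi_lipschitz:
  fixes f :: "real \<Rightarrow> real"
  assumes "L-lipschitz_on UNIV f"
  shows "integrable (Phi x) f"
proof -
  have lip: "L-lipschitz_on UNIV (\<lambda>y. f (- x + y))"
    by (rule lipschitz_on_translate[OF assms])
  have "integrable (Phi x) (\<lambda>\<xi>. f (- x + (x + \<xi>)))"
    using lipschitz_on_linear_growth[OF lip]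
    by (intro integrable_Phi_polynomial_growth[where \<beta> = 1 and C = "max \<bar>f (- x)\<bar> L"]
        borel_measurable_lipschitz[OF lip]) simp_all
  then show ?thesis by simp
qed

lemma integrable_Phi_entropy_density_self:
  "integrable (Phi x) (entropy_density (exp 1) (Phi x) (Phi x))"
proof -
  interpret prob_space "Phi x" by (rule prob_space_Phi)
  have "AE \<xi> in Phi x. 1 = RN_deriv (Phi x) (Phi x) \<xi>"
    by (rule RN_deriv_unique) (auto simp: density_1)
  then have "AE \<xi> in Phi x. entropy_density (exp 1) (Phi x) (Phi x) \<xi> = 0"
    by eventually_elim (auto simp: entropy_density_def)
  then show ?thesis
    by (subst integrable_cong_AE[where g="\<lambda>_. 0"]) auto
qed

lemma classF_polynomial_growth:
  assumes "\<phi> \<in> classF"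
  obtains C \<beta> where "0 \<le> \<beta>" "\<And>y. \<bar>\<phi> y\<bar> \<le> C * (1 + \<bar>y\<bar> powr \<beta>)"
proof -
  from assms obtain \<beta> C where "0 \<le> \<beta>" and C: "\<And>y. \<bar>\<phi> y\<bar> / (1 + \<bar>y\<bar> powr \<beta>) \<le> C"
    unfolding classF_def bdd_above_def by blast
  moreover have "\<bar>\<phi> y\<bar> \<le> C * (1 + \<bar>y\<bar> powr \<beta>)" for y
    using C[of y] by (simp add: divide_le_eq add_pos_nonneg)
  ultimately show ?thesis using that by blast
qed

lemma lipschitz_in_classF:
  assumes "L-lipschitz_on UNIV \<phi>" and "bdd_below (range \<phi>)"
  shows "\<phi> \<in> classF"
proof -
  have "\<bar>\<phi> y\<bar> / (1 + \<bar>y\<bar> powr 1) \<le> max \<bar>\<phi> 0\<bar> L" for y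
    using lipschitz_on_linear_growth[OF assms(1), of y] by (simp add: divide_le_eq add_pos_nonneg)
  then have "bdd_above (range (\<lambda>y. \<bar>\<phi> y\<bar> / (1 + \<bar>y\<bar> powr 1)))"
    by (rule bdd_aboveI2)
  then show ?thesis
    unfolding classF_def using assms(2) by (intro CollectI conjI exI[of _ 1]) simp_all
qed

lemma admissible_Phi:
  assumes "\<phi> \<in> classF" "\<phi> \<in> borel_measurable borel" "Ll-lipschitz_on UNIV l"
  shows "admissible l \<phi> x (Phi x)"
proof -
  obtain C \<beta> where "0 \<le> \<beta>" "\<And>y. \<bar>\<phi> y\<bar> \<le> C * (1 + \<bar>y\<bar> powr \<beta>)"
    using classF_polynomial_growth[OF assms(1)] by blast
  then have "integrable (Phi x) (\<lambda>\<xi>. \<phi> (x + \<xi>))"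
    using assms(2) by (intro integrable_Phi_polynomial_growth)
  moreover have "integrable (Phi x) l"
    using integrable_Phi_lipschitz[OF assms(3)] .
  ultimately show ?thesis
    unfolding admissible_def absolutely_continuous_def
    using prob_space_Phi integrable_Phi_entropy_density_self
    by simp
qed

lemma admissible_Phi_lipschitz:
  assumes "L-lipschitz_on UNIV \<phi>" "bdd_below (range \<phi>)" "Ll-lipschitz_on UNIV l"
  shows "admissible l \<phi> x (Phi x)"
  using assms by (intro admissible_Phi lipschitz_in_classF borel_measurable_lipschitz)

lemma DKL_nonneg:
  assumes "admissible l \<phi> x \<mu>"
  shows "0 \<le> DKL \<mu> (Phi x)"
proof -
  interpret information_space "Phi x" "exp 1" by (rule information_space_Phi)
  show ?thesis using assms unfolding DKL_def admissible_def
    by (intro KL_nonneg_ac) auto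
qed

definition entropic_cost ::
    "(real \<Rightarrow> real) \<Rightarrow> real \<Rightarrow> (real \<Rightarrow> real) \<Rightarrow> real \<Rightarrow> real measure \<Rightarrow> real" where
  "entropic_cost l lam \<phi> x \<mu> = (\<integral>\<xi>. \<phi> (x + \<xi>) + l \<xi> \<partial>\<mu>) + lam * DKL \<mu> (Phi x)"

lemma Mlam_eq_INF: "Mlam l lam \<phi> x = (INF \<mu>\<in>{\<mu>. admissible l \<phi> x \<mu>}. entropic_cost l lam \<phi> x \<mu>)"
  unfolding Mlam_def entropic_cost_def by (rule arg_cong[where f = Inf]) blast

lemma Mop_le:
  assumes "bdd_below (range \<phi>)" "bdd_below (range l)"
  shows "Mop l \<phi> x \<le> \<phi> (x + \<xi>) + l \<xi>"
proof -
  obtain a b where "\<And>y. a \<le> \<phi> y" "\<And>y. b \<le> l y"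
    using assms by (auto simp: bdd_below_def)
  then have "bdd_below (range (\<lambda>\<xi>. \<phi> (x + \<xi>) + l \<xi>))"
    by (intro bdd_belowI2[of _ "a + b"]) (simp add: add_mono)
  then show ?thesis unfolding Mop_def by (rule cINF_lower) simp
qed

lemma Mop_le_entropic_cost:
  assumes "bdd_below (range \<phi>)" "bdd_below (range l)" "0 \<le> lam" "admissible l \<phi> x \<mu>"
  shows "Mop l \<phi> x \<le> entropic_cost l lam \<phi> x \<mu>"
proof -
  interpret prob_space \<mu> using assms(4) unfolding admissible_def by blast
  have "Mop l \<phi> x \<le> (\<integral>\<xi>. \<phi> (x + \<xi>) + l \<xi> \<partial>\<mu>)"
    using assms Mop_le unfolding admissible_def by (intro integral_ge_const AE_I2) auto
  moreover have "0 \<le> lam * DKL \<mu> (Phi x)" using DKL_nonneg[OF assms(4)] assms(3) by simp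
  ultimately show ?thesis unfolding entropic_cost_def by linarith
qed

lemma Mlam_le_entropic_cost:
  assumes "bdd_below (range \<phi>)" "bdd_below (range l)" "0 \<le> lam" "admissible l \<phi> x \<mu>"
  shows "Mlam l lam \<phi> x \<le> entropic_cost l lam \<phi> x \<mu>"
  unfolding Mlam_eq_INF using assms Mop_le_entropic_cost[OF assms(1-3)]
  by (intro cINF_lower bdd_belowI2) auto

text \<open>The hypothesis \<open>admissible l \<phi> x (Phi x)\<close> only makes the infimum in \<open>Mlam\<close> nonempty:
  \<open>Inf {}\<close> is unspecified on the reals.\<close>

lemma Mop_le_Mlam:
  assumes "bdd_below (range \<phi>)" "bdd_below (range l)" "0 \<le> lam" "admissible l \<phi> x (Phi x)"
  shows "Mop l \<phi> x \<le> Mlam l lam \<phi> x"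
  unfolding Mlam_eq_INF using assms Mop_le_entropic_cost[OF assms(1-3)]
  by (intro cINF_greatest) auto

lemma Mlam_mono:
  assumes "bdd_below (range \<phi>)" "bdd_below (range l)" "0 \<le> lam" "lam \<le> lam'"
    and "admissible l \<phi> x (Phi x)"
  shows "Mlam l lam \<phi> x \<le> Mlam l lam' \<phi> x"
  unfolding Mlam_eq_INF
proof (rule cINF_mono)
  show "{\<mu>. admissible l \<phi> x \<mu>} \<noteq> {}" using assms(5) by blast
  show "bdd_below (entropic_cost l lam \<phi> x ` {\<mu>. admissible l \<phi> x \<mu>})"
    using Mop_le_entropic_cost[OF assms(1-3)] by (intro bdd_belowI2) auto
  fix \<mu> assume "\<mu> \<in> {\<mu>. admissible l \<phi> x \<mu>}"
  then have "lam * DKL \<mu> (Phi x) \<le> lam' * DKL \<mu> (Phi x)"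
    using DKL_nonneg assms(4) by (intro mult_right_mono) auto
  then show "\<exists>\<nu>\<in>{\<mu>. admissible l \<phi> x \<mu>}. entropic_cost l lam \<phi> x \<nu> \<le> entropic_cost l lam' \<phi> x \<mu>"
    using \<open>\<mu> \<in> _\<close> unfolding entropic_cost_def by force
qed

lemma uniform_measure_interval:
  fixes a d :: real
  assumes "0 < d"
  shows "uniform_measure lborel {a - d..a + d} =
    density lborel (\<lambda>\<xi>. indicator {a - d..a + d} \<xi> / (2 * d))"
  unfolding uniform_measure_def using assms
  by (intro density_cong) (auto simp: divide_ennreal[symmetric] ennreal_mult split: split_indicator)

lemma prob_space_uniform_interval:
  "0 < (d::real) \<Longrightarrow> prob_space (uniform_measure lborel {a - d..a + d})"
  by (intro prob_space_uniform_measure) simp_all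

lemma absolutely_continuous_Phi_uniform:
  assumes [measurable]: "A \<in> sets borel"
  shows "absolutely_continuous (Phi x) (uniform_measure lborel A)"
proof -
  have "absolutely_continuous lborel (uniform_measure lborel A)"
    unfolding uniform_measure_def by (intro absolutely_continuousI_density) measurable
  then show ?thesis by (simp add: absolutely_continuous_def null_sets_Phi)
qed

lemma
  fixes f :: "real \<Rightarrow> real"
  assumes lip: "L-lipschitz_on UNIV f" and "0 < d"
  shows integrable_uniform_interval_lipschitz:
      "integrable (uniform_measure lborel {a - d..a + d}) f"
    and integral_uniform_interval_lipschitz_le:
      "(\<integral>\<xi>. f \<xi> \<partial>uniform_measure lborel {a - d..a + d}) \<le> f a + L * d"
proof -
  interpret prob_space "uniform_measure lborel {a - d..a + d}"
    using prob_space_uniform_interval[OF \<open>0 < d\<close>] .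
  have [measurable]: "f \<in> borel_measurable borel"
    using lip by (rule borel_measurable_lipschitz)
  have "AE \<xi> in uniform_measure lborel {a - d..a + d}. \<xi> \<in> {a - d..a + d}"
    by (rule AE_in_uniform_measure) simp
  then have close: "AE \<xi> in uniform_measure lborel {a - d..a + d}. \<bar>f \<xi> - f a\<bar> \<le> L * d"
  proof eventually_elim
    case (elim \<xi>)
    have "\<bar>f \<xi> - f a\<bar> \<le> L * \<bar>\<xi> - a\<bar>"
      using lipschitz_onD[OF lip] by (simp add: dist_real_def)
    also have "\<dots> \<le> L * d"
      using elim lipschitz_on_nonneg[OF lip]
      by (intro mult_left_mono) (simp_all add: abs_diff_le_iff)
    finally show ?case .
  qed
  show int: "integrable (uniform_measure lborel {a - d..a + d}) f"
    using close by (intro integrable_const_bound[where B = "\<bar>f a\<bar> + L * d"]) auto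
  show "(\<integral>\<xi>. f \<xi> \<partial>uniform_measure lborel {a - d..a + d}) \<le> f a + L * d"
    using close by (intro integral_le_const[OF int]) auto
qed

lemma AE_entropy_density_uniform_Phi:
  fixes a d :: real
  assumes "0 < d"
  shows "AE \<xi> in uniform_measure lborel {a - d..a + d}.
    entropy_density (exp 1) (Phi x) (uniform_measure lborel {a - d..a + d}) \<xi> =
      ln (sqrt (2 * pi)) - ln (2 * d) + (x + \<xi>)\<^sup>2 / 2"
proof -
  let ?g = "\<lambda>\<xi>. indicator {a - d..a + d} \<xi> / (2 * d) :: real"
  have "AE \<xi> in density lborel ?g.
      entropy_density (exp 1) (Phi x) (density lborel ?g) \<xi> =
        log (exp 1) (?g \<xi> / normal_density (- x) 1 \<xi>)"
    unfolding Phi_def using assms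
    by (intro lborel.AE_entropy_density_density) (auto simp: normal_density_pos)
  moreover have "AE \<xi> in density lborel ?g. \<xi> \<in> {a - d..a + d}"
    using AE_in_uniform_measure[of "{a - d..a + d}" lborel]
    unfolding uniform_measure_interval[OF assms] by simp
  ultimately show ?thesis
    unfolding uniform_measure_interval[OF assms]
  proof eventually_elim
    case (elim \<xi>)
    have pos: "0 < normal_density (- x) 1 \<xi>" by (rule normal_density_pos) simp
    have "log (exp 1) (?g \<xi> / normal_density (- x) 1 \<xi>) =
        - ln (2 * d) - ln (normal_density (- x) 1 \<xi>)"
      using elim(2) assms pos by (simp add: log_ln[symmetric] ln_div ln_mult)
    also have "ln (normal_density (- x) 1 \<xi>) = - ln (sqrt (2 * pi)) - (x + \<xi>)\<^sup>2 / 2"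
      unfolding normal_density_def by (simp add: ln_div add.commute)
    finally show ?case using elim(1) by simp
  qed
qed

lemma
  fixes a d :: real
  assumes "0 < d"
  defines "U \<equiv> uniform_measure lborel {a - d..a + d}"
  shows integrable_entropy_density_uniform_Phi: "integrable U (entropy_density (exp 1) (Phi x) U)"
    and DKL_uniform_Phi_le: "DKL U (Phi x) \<le> ln (sqrt (2 * pi)) - ln (2 * d) + (\<bar>x + a\<bar> + d)\<^sup>2 / 2"
proof -
  interpret prob_space U
    using assms(1) unfolding U_def by (rule prob_space_uniform_interval)
  let ?c = "ln (sqrt (2 * pi)) - ln (2 * d)"
  have "AE \<xi> in U. \<xi> \<in> {a - d..a + d}"
    unfolding U_def by (rule AE_in_uniform_measure) simp
  with AE_entropy_density_uniform_Phi[OF assms(1), where a = a and x = x]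
  have bound: "AE \<xi> in U. entropy_density (exp 1) (Phi x) U \<xi> = ?c + (x + \<xi>)\<^sup>2 / 2
      \<and> (x + \<xi>)\<^sup>2 \<le> (\<bar>x + a\<bar> + d)\<^sup>2"
    unfolding U_def
  proof eventually_elim
    case (elim \<xi>)
    have "\<bar>\<xi> - a\<bar> \<le> d"
      using elim(2) by (simp add: abs_diff_le_iff)
    then have "\<bar>x + \<xi>\<bar> \<le> \<bar>x + a\<bar> + d"
      using abs_triangle_ineq[of "x + a" "\<xi> - a"] by simp
    then have "\<bar>x + \<xi>\<bar>\<^sup>2 \<le> (\<bar>x + a\<bar> + d)\<^sup>2"
      by (intro power_mono) simp_all
    with elim(1) show ?case by simp
  qed
  have [measurable]: "entropy_density (exp 1) (Phi x) U \<in> borel_measurable U"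
    unfolding U_def by measurable
  have "AE \<xi> in U. norm (entropy_density (exp 1) (Phi x) U \<xi>) \<le> \<bar>?c\<bar> + (\<bar>x + a\<bar> + d)\<^sup>2 / 2"
    using bound
  proof eventually_elim
    case (elim \<xi>)
    have "0 \<le> (x + \<xi>)\<^sup>2" by simp
    with elim abs_ge_self[of ?c] abs_ge_minus_self[of ?c] show ?case
      unfolding real_norm_def abs_le_iff by (intro conjI) linarith+
  qed
  then show int: "integrable U (entropy_density (exp 1) (Phi x) U)"
    by (intro integrable_const_bound) auto
  show "DKL U (Phi x) \<le> ?c + (\<bar>x + a\<bar> + d)\<^sup>2 / 2"
    unfolding DKL_def KL_divergence_def
    using bound by (intro integral_le_const[OF int]) auto
qed

lemma admissible_uniform:
  fixes a d :: real
  assumes "L-lipschitz_on UNIV \<phi>" "Ll-lipschitz_on UNIV l" "0 < d"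
  shows "admissible l \<phi> x (uniform_measure lborel {a - d..a + d})"
  unfolding admissible_def
  using assms prob_space_uniform_interval absolutely_continuous_Phi_uniform
    integrable_entropy_density_uniform_Phi
    integrable_uniform_interval_lipschitz[OF lipschitz_on_add[OF lipschitz_on_translate]]
  by simp

lemma Mlam_le_uniform:
  fixes a d :: real
  assumes "bdd_below (range \<phi>)" "bdd_below (range l)" "0 \<le> lam"
    and lip: "L-lipschitz_on UNIV \<phi>" "Ll-lipschitz_on UNIV l" and "0 < d"
  shows "Mlam l lam \<phi> x \<le> \<phi> (x + a) + l a + (L + Ll) * d
    + lam * (ln (sqrt (2 * pi)) - ln (2 * d) + (\<bar>x + a\<bar> + d)\<^sup>2 / 2)"
proof -
  let ?U = "uniform_measure lborel {a - d..a + d}"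
  have "Mlam l lam \<phi> x \<le> entropic_cost l lam \<phi> x ?U"
    using assms admissible_uniform by (intro Mlam_le_entropic_cost) auto
  also have "\<dots> \<le> \<phi> (x + a) + l a + (L + Ll) * d
    + lam * (ln (sqrt (2 * pi)) - ln (2 * d) + (\<bar>x + a\<bar> + d)\<^sup>2 / 2)"
    unfolding entropic_cost_def
    using integral_uniform_interval_lipschitz_le
        [OF lipschitz_on_add[OF lipschitz_on_translate[OF lip(1)] lip(2)] \<open>0 < d\<close>, of a]
      DKL_uniform_Phi_le[OF \<open>0 < d\<close>, where a = a and x = x] \<open>0 \<le> lam\<close>
    by (intro add_mono mult_left_mono) auto
  finally show ?thesis .
qed

lemma bounded_near_minimizers:
  assumes "bdd_below (range \<phi>)" "bdd_below (range l)" "continuous_on K \<phi>" "compact K"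
    and "filterlim l at_top at_infinity"
  obtains S where "\<And>x a. x \<in> K \<Longrightarrow> \<phi> (x + a) + l a \<le> Mop l \<phi> x + \<eta> \<Longrightarrow> \<bar>x + a\<bar> \<le> S"
proof -
  obtain c where c: "\<And>y. c \<le> \<phi> y"
    using assms(1) by (auto simp: bdd_below_def)
  have "bdd_above (\<phi> ` K)"
    using assms(3,4) by (intro bounded_imp_bdd_above compact_imp_bounded compact_continuous_image)
  then obtain M where M: "\<And>x. x \<in> K \<Longrightarrow> \<phi> x \<le> M"
    by (auto simp: bdd_above_def)
  obtain Rk where Rk: "\<And>x. x \<in> K \<Longrightarrow> \<bar>x\<bar> \<le> Rk"
    using compact_imp_bounded[OF assms(4)] by (auto simp: bounded_iff)
  have "\<forall>\<^sub>F \<xi> in at_infinity. M + l 0 + \<eta> - c < l \<xi>"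
    using assms(5) by (simp add: filterlim_at_top_dense)
  then obtain R where R: "\<And>\<xi>. R \<le> norm \<xi> \<Longrightarrow> M + l 0 + \<eta> - c < l \<xi>"
    by (auto simp: eventually_at_infinity)
  show thesis
  proof (rule that)
    fix x a
    assume "x \<in> K" and near: "\<phi> (x + a) + l a \<le> Mop l \<phi> x + \<eta>"
    have "Mop l \<phi> x \<le> \<phi> x + l 0"
      using Mop_le[OF assms(1,2), of x 0] by simp
    then have "l a \<le> M + l 0 + \<eta> - c"
      using near c[of "x + a"] M[OF \<open>x \<in> K\<close>] by linarith
    then have "\<bar>a\<bar> \<le> R"
      using R[of a] by fastforce
    then show "\<bar>x + a\<bar> \<le> Rk + R"
      using Rk[OF \<open>x \<in> K\<close>] abs_triangle_ineq[of x a] by linarith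
  qed
qed

lemma Mlam_le_Mop_add:
  assumes "bdd_below (range \<phi>)" "bdd_below (range l)" "0 \<le> lam"
    and lip: "L-lipschitz_on UNIV \<phi>" "Ll-lipschitz_on UNIV l" and "0 < d" "0 < \<eta>"
    and near_bounded: "\<And>a. \<phi> (x + a) + l a \<le> Mop l \<phi> x + \<eta> \<Longrightarrow> \<bar>x + a\<bar> \<le> S"
  shows "Mlam l lam \<phi> x \<le> Mop l \<phi> x + \<eta> + (L + Ll) * d
    + lam * (ln (sqrt (2 * pi)) - ln (2 * d) + (S + d)\<^sup>2 / 2)"
proof -
  obtain a where a: "\<phi> (x + a) + l a < Mop l \<phi> x + \<eta>"
    using cInf_lessD[of "range (\<lambda>\<xi>. \<phi> (x + \<xi>) + l \<xi>)" "Mop l \<phi> x + \<eta>"] \<open>0 < \<eta>\<close>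
    unfolding Mop_def by auto
  then have "\<bar>x + a\<bar> + d \<le> S + d"
    using near_bounded by simp
  then have "(\<bar>x + a\<bar> + d)\<^sup>2 \<le> (S + d)\<^sup>2"
    using \<open>0 < d\<close> by (intro power_mono) simp_all
  then have "lam * (ln (sqrt (2 * pi)) - ln (2 * d) + (\<bar>x + a\<bar> + d)\<^sup>2 / 2)
      \<le> lam * (ln (sqrt (2 * pi)) - ln (2 * d) + (S + d)\<^sup>2 / 2)"
    using \<open>0 \<le> lam\<close> by (intro mult_left_mono) simp_all
  then show ?thesis
    using Mlam_le_uniform[OF assms(1-6), of x a] a by linarith
qed

lemma uniform_limit_Mlam_Mop:
  assumes lip: "L-lipschitz_on UNIV \<phi>" "Ll-lipschitz_on UNIV l"
    and bdd: "bdd_below (range \<phi>)" "bdd_below (range l)"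
    and coercive: "filterlim l at_top at_infinity" and "compact K"
  shows "uniform_limit K (\<lambda>lam. Mlam l lam \<phi>) (Mop l \<phi>) (at_right 0)"
  unfolding uniform_limit_iff
proof (intro allI impI)
  fix e :: real
  assume "0 < e"
  have "continuous_on K \<phi>"
    using lip(1) by (rule lipschitz_on_continuous_on[OF lipschitz_on_subset]) simp
  then obtain S where S: "\<And>x a. x \<in> K \<Longrightarrow> \<phi> (x + a) + l a \<le> Mop l \<phi> x + e / 3 \<Longrightarrow> \<bar>x + a\<bar> \<le> S"
    using bounded_near_minimizers[OF bdd _ \<open>compact K\<close> coercive] by blast
  define d where "d = e / (3 * (L + Ll + 1))"
  have "0 \<le> L" "0 \<le> Ll"
    using lip by (simp_all add: lipschitz_on_nonneg)
  then have "0 < d" and d: "(L + Ll) * d \<le> e / 3"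
    using \<open>0 < e\<close> by (simp_all add: d_def field_simps)
  define B where "B = ln (sqrt (2 * pi)) - ln (2 * d) + (S + d)\<^sup>2 / 2"
  have "((\<lambda>lam. lam * B) \<longlongrightarrow> 0) (at_right 0)"
    by (intro tendsto_mult_left_zero tendsto_ident_at)
  moreover have "0 < e / 3"
    using \<open>0 < e\<close> by simp
  ultimately have "\<forall>\<^sub>F lam in at_right 0. lam * B < e / 3"
    by (rule order_tendstoD(2))
  with eventually_at_right_less[of 0]
  show "\<forall>\<^sub>F lam in at_right 0. \<forall>x\<in>K. dist (Mlam l lam \<phi> x) (Mop l \<phi> x) < e"
  proof (eventually_elim, intro ballI)
    fix lam x
    assume lam: "0 < lam" "lam * B < e / 3" and "x \<in> K"
    have "Mop l \<phi> x \<le> Mlam l lam \<phi> x"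
      using lam(1) admissible_Phi_lipschitz[OF lip(1) bdd(1) lip(2)]
      by (intro Mop_le_Mlam[OF bdd]) simp_all
    moreover have "Mlam l lam \<phi> x \<le> Mop l \<phi> x + e / 3 + (L + Ll) * d + lam * B"
      unfolding B_def using lam(1) \<open>0 < d\<close> \<open>0 < e\<close> S[OF \<open>x \<in> K\<close>]
      by (intro Mlam_le_Mop_add[OF bdd _ lip]) simp_all
    ultimately show "dist (Mlam l lam \<phi> x) (Mop l \<phi> x) < e"
      using d lam(2) by (simp add: dist_real_def)
  qed
qed

theorem lemma3p3:
  fixes l :: "real \<Rightarrow> real" and K0 Ll :: real
  assumes K0pos: "K0 > 0"
    and l0: "l 0 = K0" and lmin: "\<And>x. l x \<ge> K0"
    and lsub: "\<And>x y. l x + l y \<ge> l (x + y) + K0"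
    and lcoer: "filterlim l at_top at_infinity"
    and llip: "Ll-lipschitz_on UNIV l"
  shows
    "(\<forall>\<phi> lam lam'. (\<exists>L. L-lipschitz_on UNIV \<phi>) \<longrightarrow> bdd_below (range \<phi>) \<longrightarrow>
        0 < lam \<longrightarrow> lam < lam' \<longrightarrow> (\<forall>x. Mlam l lam \<phi> x \<le> Mlam l lam' \<phi> x))
     \<and> (\<forall>\<phi> lam. lam > 0 \<longrightarrow> \<phi> \<in> classF \<longrightarrow> \<phi> \<in> borel_measurable borel \<longrightarrow>
        (\<forall>x. Mop l \<phi> x \<le> Mlam l lam \<phi> x))
     \<and> (\<forall>\<phi> K. (\<exists>L. L-lipschitz_on UNIV \<phi>) \<longrightarrow> bdd_below (range \<phi>) \<longrightarrow> compact K \<longrightarrow>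
        uniform_limit K (\<lambda>lam. Mlam l lam \<phi>) (Mop l \<phi>) (at_right 0))"
proof -
  have l_bdd: "bdd_below (range l)"
    using lmin by (intro bdd_belowI2)
  show ?thesis
  proof (intro conjI allI impI)
    fix \<phi> :: "real \<Rightarrow> real" and lam lam' x :: real
    assume "\<exists>L. L-lipschitz_on UNIV \<phi>" and \<phi>_bdd: "bdd_below (range \<phi>)"
      and "0 < lam" "lam < lam'"
    then obtain L where "L-lipschitz_on UNIV \<phi>" by blast
    then have "admissible l \<phi> x (Phi x)"
      using \<phi>_bdd llip by (rule admissible_Phi_lipschitz)
    then show "Mlam l lam \<phi> x \<le> Mlam l lam' \<phi> x"
      using \<phi>_bdd l_bdd \<open>0 < lam\<close> \<open>lam < lam'\<close> by (intro Mlam_mono) simp_all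
  next
    fix \<phi> :: "real \<Rightarrow> real" and lam x :: real
    assume "0 < lam" "\<phi> \<in> classF" "\<phi> \<in> borel_measurable borel"
    moreover from this have "admissible l \<phi> x (Phi x)"
      using llip by (intro admissible_Phi)
    ultimately show "Mop l \<phi> x \<le> Mlam l lam \<phi> x"
      using l_bdd unfolding classF_def by (intro Mop_le_Mlam) simp_all
  next
    fix \<phi> :: "real \<Rightarrow> real" and K :: "real set"
    assume "\<exists>L. L-lipschitz_on UNIV \<phi>" "bdd_below (range \<phi>)" "compact K"
    then show "uniform_limit K (\<lambda>lam. Mlam l lam \<phi>) (Mop l \<phi>) (at_right 0)"
      using llip l_bdd lcoer uniform_limit_Mlam_Mop by blast
  qed
qed

end
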